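(* Consider the two differential equations $$\dot E=-G_\varepsilon^{\mathcal S}(E)+\operatorname{Re}\langle G_\varepsilon^{\mathcal S}(E),E\rangle\,E \quad\text{for } E\in\mathcal S,\ \|E\|_F=1, \qquad (1)$$ $$\dot Y=-P_YG_\varepsilon(E)+\operatorname{Re}\langle P_YG_\varepsilon(E),E\rangle\,Y\quad\text{with } E=\Pi^{\mathcal S}Y,\ \|E\|_F=1,\quad\text{for } Y\in\mathcal M_1. \qquad (2)$$ (a) Let $E\in\mathcal S$ of unit Frobenius norm be a stationary point of (1) that satisfies $\Pi^{\mathcal S}G_\varepsilon(E)\neq0$. Then $E=\Pi^{\mathcal S}Y$ for a certain matrix $Y\in\mathcal M_1$ that is a stationary point of (2). (b) Conversely, let $Y\in\mathcal M_1$ be a stationary point of (2) such that $E=\Pi^{\mathcal S}Y$ has unit Frobenius norm and $P_YG_\varepsilon(E)\neq0$. Then $P_YG_\varepsilon(E)=G_\varepsilon(E)$, $Y$ is a nonzero real multiple of $G_\varepsilon(E)$, and $E$ is a stationary point of (1).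
   Context: $A\in\mathbb{C}^{n\times n}$ is given, $\varepsilon>0$, and $\mathcal S\subset\mathbb{C}^{n\times n}$ is a (real- or complex-linear) subspace. $\langle X,Y\rangle=\operatorname{tr}(X^*Y)$, $\|X\|_F=\langle X,X\rangle^{1/2}$. $\Pi^{\mathcal S}$ is the orthogonal projection onto $\mathcal S$ with respect to $\operatorname{Re}\langle\cdot,\cdot\rangle$. $\lambda(M)$ denotes a chosen target eigenvalue of a matrix $M$ (e.g. an eigenvalue of largest real part, or of largest or smallest modulus). Standing assumption: the target eigenvalue $\lambda=\lambda(A+\varepsilon E)$ is simple at the matrices $E$ considered. $f:\mathbb{C}^2\to\mathbb{C}$ is smooth with $f(z,\overline z)=f(\overline z,z)\in\mathbb{R}$ for all $z\in\mathbb{C}$. Let $x,y$ be left and right eigenvectors of $A+\varepsilon E$ for $\lambda$ (i.e. $x^*(A+\varepsilon E)=\lambda x^*$, $(A+\varepsilon E)y=\lambda y$) normalized by $\|x\|=\|y\|=1$ and $x^*y>0$; set $G_\varepsilon(E)=2f_{\overline\lambda}\,xy^*$ with $f_{\overline\lambda}=\frac{\partial f}{\partial\overline\lambda}(\lambda,\overline\lambda)$ (the Wirtinger derivative of $z\mapsto f(z,\overline z)$ with respect to $\overline z$), which does not depend on the choice of normalized eigenvectors, and $G_\varepsilon^{\mathcal S}(E)=\Pi^{\mathcal S}G_\varepsilon(E)$. $\mathcal M_1$ is the manifold of complex $n\times n$ matrices of rank exactly $1$. For $Y=\sigma uv^*\in\mathcal M_1$ with $\|u\|=\|v\|=1$,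 $P_Y$ is the orthogonal projection onto the tangent space $T_Y\mathcal M_1$, given by $P_Y(Z)=Z-(I-uu^* )Z(I-vv^* )$. A stationary point of a differential equation is a point where its right-hand side vanishes. *)

theory Defs
  imports "HOL-Analysis.Analysis" "HOL-Computational_Algebra.Polynomial"
begin

section \<open>Complex matrices\<close>

definition cmat_adj :: "complex^'n^'m \<Rightarrow> complex^'m^'n" where
  "cmat_adj M = (\<chi> i j. cnj (M $ j $ i))"

definition cvec_cnj :: "complex^'n \<Rightarrow> complex^'n" where
  "cvec_cnj x = (\<chi> i. cnj (x $ i))"

text \<open>\<open>x\<^sup>* y\<close>, conjugate-linear in the first argument.\<close>
definition cdot :: "complex^'n \<Rightarrow> complex^'n \<Rightarrow> complex" where
  "cdot x y = (\<Sum>i\<in>UNIV. cnj (x $ i) * y $ i)"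

text \<open>\<open>x y\<^sup>*\<close>.\<close>
definition outer :: "complex^'m \<Rightarrow> complex^'n \<Rightarrow> complex^'n^'m" where
  "outer x y = (\<chi> i j. x $ i * cnj (y $ j))"

definition frob_inner :: "complex^'n^'n \<Rightarrow> complex^'n^'n \<Rightarrow> complex" where
  "frob_inner X Y = trace (cmat_adj X ** Y)"

definition frob_norm :: "complex^'n^'n \<Rightarrow> real" where
  "frob_norm X = sqrt (Re (frob_inner X X))"

text \<open>Orthogonal projection onto a real-linear subspace \<open>S\<close> with respect to
  \<open>Re \<langle>\<cdot>,\<cdot>\<rangle>\<close>. A complex-linear subspace is in particular a real-linear one.\<close>
definition orth_proj :: "(complex^'n^'n) set \<Rightarrow> complex^'n^'n \<Rightarrow> complex^'n^'n" where
  "orth_proj S Z = (THE W. W \<in> S \<and> (\<forall>V\<in>S. Re (frob_inner V (Z - W)) = 0))"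


section \<open>Target eigenvalue and gradient\<close>

definition is_eigenvalue :: "complex^'n^'n \<Rightarrow> complex \<Rightarrow> bool" where
  "is_eigenvalue M l \<longleftrightarrow> (\<exists>v. v \<noteq> 0 \<and> M *v v = l *s v)"

text \<open>The characteristic polynomial \<open>det (z I - M)\<close>, as a determinant over the polynomial ring.\<close>
definition charpoly :: "complex^'n^'n \<Rightarrow> complex poly" where
  "charpoly M = det (\<chi> i j. (if i = j then [:0, 1:] else 0) - [:M $ i $ j:])"

definition simple_eigenvalue :: "complex^'n^'n \<Rightarrow> complex \<Rightarrow> bool" where
  "simple_eigenvalue M l \<longleftrightarrow> is_eigenvalue M l \<and> order l (charpoly M) = 1"

definition normalized_eigvecs ::
    "complex^'n^'n \<Rightarrow> complex \<Rightarrow> complex^'n \<Rightarrow> complex^'n \<Rightarrow> bool" where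
  "normalized_eigvecs M l x y \<longleftrightarrow>
     cvec_cnj x v* M = l *s cvec_cnj x \<and> M *v y = l *s y \<and>
     norm x = 1 \<and> norm y = 1 \<and> cdot x y \<in> \<real> \<and> Re (cdot x y) > 0"

text \<open>Derivative of \<open>g\<close> with respect to the conjugate variable,
  \<open>(\<partial>g/\<partial>x + i \<partial>g/\<partial>y) / 2\<close> for \<open>z = x + i y\<close>.\<close>
definition wirtinger_cnj :: "(complex \<Rightarrow> complex) \<Rightarrow> complex \<Rightarrow> complex" where
  "wirtinger_cnj g z = (frechet_derivative g (at z) 1 + \<i> * frechet_derivative g (at z) \<i>) / 2"

text \<open>Real differentiability of class \<open>C\<^sup>k\<close> on the whole space.\<close>
primrec Ck_fun :: "nat \<Rightarrow> ('a::euclidean_space \<Rightarrow> 'b::euclidean_space) \<Rightarrow> bool" where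
  "Ck_fun 0 f \<longleftrightarrow> continuous_on UNIV f"
| "Ck_fun (Suc k) f \<longleftrightarrow> (\<forall>x. f differentiable (at x)) \<and>
     (\<forall>v. Ck_fun k (\<lambda>x. frechet_derivative f (at x) v))"

definition smooth_fun :: "('a::euclidean_space \<Rightarrow> 'b::euclidean_space) \<Rightarrow> bool" where
  "smooth_fun f \<longleftrightarrow> (\<forall>k. Ck_fun k f)"

text \<open>\<open>G_\<epsilon>(E) = 2 f_\<lambda> x y\<^sup>*\<close>, with \<open>f_\<lambda>\<close> the derivative in the conjugate variable.
  At a simple eigenvalue the pair \<open>(x, y)\<close> exists and is unique up to a common unimodular
  factor, which leaves \<open>x y\<^sup>*\<close> unchanged; so the choice made here is immaterial.\<close>
definition gradient ::
    "complex^'n^'n \<Rightarrow> real \<Rightarrow> (complex^'n^'n \<Rightarrow> complex) \<Rightarrow> (complex \<times> complex \<Rightarrow> complex)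
       \<Rightarrow> complex^'n^'n \<Rightarrow> complex^'n^'n" where
  "gradient A \<epsilon> lam f E =
     (let M = A + \<epsilon> *\<^sub>R E; l = lam M;
          (x, y) = (SOME (x, y). normalized_eigvecs M l x y)
      in outer ((2 * wirtinger_cnj (\<lambda>z. f (z, cnj z)) l) *s x) y)"


section \<open>The rank-1 manifold\<close>

definition rank_one :: "(complex^'n^'n) set" where
  "rank_one = {Y. rank Y = 1}"

text \<open>Velocities at \<open>Y\<close> of curves in \<open>rank_one\<close>; differentiability at the base point is enough,
  since \<open>rank_one\<close> is an embedded manifold.\<close>
definition tangent_space :: "complex^'n^'n \<Rightarrow> (complex^'n^'n) set" where
  "tangent_space Y = {Z. \<exists>\<gamma> :: real \<Rightarrow> complex^'n^'n. \<gamma> 0 = Y \<and>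
     (\<forall>\<^sub>F t in nhds 0. \<gamma> t \<in> rank_one) \<and> (\<gamma> has_vector_derivative Z) (at 0)}"

definition tangent_proj :: "complex^'n^'n \<Rightarrow> complex^'n^'n \<Rightarrow> complex^'n^'n" where
  "tangent_proj Y = orth_proj (tangent_space Y)"


section \<open>The two differential equations\<close>

text \<open>\<open>G\<close> stands for the map \<open>E \<mapsto> G_\<epsilon>(E)\<close>.\<close>

definition rhs1 :: "(complex^'n^'n) set \<Rightarrow> (complex^'n^'n \<Rightarrow> complex^'n^'n)
    \<Rightarrow> complex^'n^'n \<Rightarrow> complex^'n^'n" where
  "rhs1 S G E = - orth_proj S (G E) + Re (frob_inner (orth_proj S (G E)) E) *\<^sub>R E"

definition stationary1 :: "(complex^'n^'n) set \<Rightarrow> (complex^'n^'n \<Rightarrow> complex^'n^'n)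
    \<Rightarrow> complex^'n^'n \<Rightarrow> bool" where
  "stationary1 S G E \<longleftrightarrow> E \<in> S \<and> frob_norm E = 1 \<and> rhs1 S G E = 0"

definition rhs2 :: "(complex^'n^'n) set \<Rightarrow> (complex^'n^'n \<Rightarrow> complex^'n^'n)
    \<Rightarrow> complex^'n^'n \<Rightarrow> complex^'n^'n" where
  "rhs2 S G Y = (let E = orth_proj S Y in
     - tangent_proj Y (G E) + Re (frob_inner (tangent_proj Y (G E)) E) *\<^sub>R Y)"

definition stationary2 :: "(complex^'n^'n) set \<Rightarrow> (complex^'n^'n \<Rightarrow> complex^'n^'n)
    \<Rightarrow> complex^'n^'n \<Rightarrow> bool" where
  "stationary2 S G Y \<longleftrightarrow> Y \<in> rank_one \<and> frob_norm (orth_proj S Y) = 1 \<and> rhs2 S G Y = 0"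


section \<open>Well-definedness\<close>

lemma Re_frob_inner: "Re (frob_inner X Y) = inner X Y"
proof -
  have "Re (frob_inner X Y) = (\<Sum>i\<in>UNIV. \<Sum>k\<in>UNIV. inner (X $ k $ i) (Y $ k $ i))"
    by (simp add: frob_inner_def trace_def cmat_adj_def matrix_matrix_mult_def inner_complex_def)
  also have "\<dots> = inner X Y"
    unfolding inner_vec_def by (rule sum.swap)
  finally show ?thesis .
qed

lemma frob_norm_eq_norm: "frob_norm X = norm X"
  by (simp add: frob_norm_def Re_frob_inner norm_eq_sqrt_inner)

lemma orth_proj_eqI:
  assumes S: "subspace S" and W: "W \<in> S" "\<And>V. V \<in> S \<Longrightarrow> Re (frob_inner V (Z - W)) = 0"
  shows "orth_proj S Z = W"
  unfolding orth_proj_def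
proof (rule the_equality)
  fix W' assume W': "W' \<in> S \<and> (\<forall>V\<in>S. Re (frob_inner V (Z - W')) = 0)"
  have d: "W' - W \<in> S" using S W W' by (simp add: subspace_diff)
  have "inner (W' - W) (Z - W) = 0" "inner (W' - W) (Z - W') = 0"
    using d W W' by (auto simp flip: Re_frob_inner)
  then have "inner (W' - W) (W' - W) = 0" by (simp add: inner_diff_right)
  then show "W' = W" by simp
qed (use W in auto)

lemma orth_proj_exists:
  assumes S: "subspace S"
  shows "orth_proj S Z \<in> S" "V \<in> S \<Longrightarrow> Re (frob_inner V (Z - orth_proj S Z)) = 0"
proof -
  obtain y z where y: "y \<in> span S" and z: "\<And>w. w \<in> span S \<Longrightarrow> orthogonal z w" and e: "Z = y + z"
    using orthogonal_subspace_decomp_exists by metis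
  have y': "y \<in> S" using S y span_eq_iff by blast
  have o: "V \<in> S \<Longrightarrow> Re (frob_inner V (Z - y)) = 0" for V
    using z[of V] e by (simp add: Re_frob_inner orthogonal_def inner_commute span_base)
  have "orth_proj S Z = y" by (rule orth_proj_eqI[OF S y' o])
  then show "orth_proj S Z \<in> S" "V \<in> S \<Longrightarrow> Re (frob_inner V (Z - orth_proj S Z)) = 0"
    using y' o by auto
qed

lemma rank_eq_1_iff: "rank Y = 1 \<longleftrightarrow> (\<exists>a b. a \<noteq> 0 \<and> b \<noteq> 0 \<and> Y = outer a b)"
  for Y :: "complex^'n^'m"
proof
  assume "rank Y = 1"
  then have d: "vec.dim (rows Y) = 1" by (simp add: row_rank_def_gen)
  obtain B where B: "B \<subseteq> rows Y" "vec.independent B" "rows Y \<subseteq> vec.span B" "card B = 1"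
    using vec.basis_exists[of "rows Y"] d by metis
  obtain r where r: "B = {r}" using B(4) card_1_singletonE by blast
  have r0: "r \<noteq> 0" using B(2) r vec.dependent_single by blast
  have "\<forall>i. \<exists>c. row i Y = c *s r"
  proof
    fix i
    have "row i Y \<in> rows Y" by (auto simp: rows_def)
    then show "\<exists>c. row i Y = c *s r" using B(3) r by (auto simp: vec.span_singleton)
  qed
  then obtain c where c: "\<And>i. row i Y = c i *s r" by metis
  have Y: "Y = outer (\<chi> i. c i) (cvec_cnj r)"
  proof -
    have "Y $ i $ j = c i * r $ j" for i j
      using c[of i] by (simp add: row_def vec_eq_iff)
    then show ?thesis by (simp add: outer_def cvec_cnj_def vec_eq_iff)
  qed
  have "cvec_cnj r \<noteq> 0" using r0 by (auto simp: cvec_cnj_def vec_eq_iff)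
  moreover have "(\<chi> i. c i) \<noteq> 0"
  proof
    assume "(\<chi> i. c i) = 0"
    then have "row i Y = 0" for i using c[of i] by (simp add: vec_eq_iff)
    moreover have "r \<in> rows Y" using B r by auto
    ultimately show False using r0 by (auto simp: rows_def)
  qed
  ultimately show "\<exists>a b. a \<noteq> 0 \<and> b \<noteq> 0 \<and> Y = outer a b" using Y by blast
next
  assume "\<exists>a b. a \<noteq> 0 \<and> b \<noteq> 0 \<and> Y = outer a b"
  then obtain a b where ab: "a \<noteq> 0" "b \<noteq> 0" "Y = outer a b" by blast
  have row: "row i Y = a $ i *s cvec_cnj b" for i
    by (simp add: ab row_def outer_def cvec_cnj_def vec_eq_iff)
  have b0: "cvec_cnj b \<noteq> 0" using ab by (auto simp: cvec_cnj_def vec_eq_iff)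
  obtain i where i: "a $ i \<noteq> 0" using ab by (auto simp: vec_eq_iff)
  have r: "row i Y \<in> rows Y" by (auto simp: rows_def)
  have "cvec_cnj b = inverse (a $ i) *s row i Y"
    using i by (simp add: row vec_eq_iff)
  then have "cvec_cnj b \<in> vec.span (rows Y)"
    using r by (metis vec.span_base vec.span_scale)
  moreover have "rows Y \<subseteq> vec.span {cvec_cnj b}"
    by (auto simp: rows_def row vec.span_singleton)
  ultimately have "vec.span (rows Y) = vec.span {cvec_cnj b}"
    by (intro subset_antisym vec.span_minimal vec.subspace_span) auto
  then have "vec.dim (rows Y) = vec.dim {cvec_cnj b}" using vec.dim_span[of "rows Y"] vec.dim_span[of "{cvec_cnj b}"] by simp
  also have "\<dots> = 1" using b0 vec.dim_eq_card_independent[of "{cvec_cnj b}"]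
    by (simp add: vec.dependent_single)
  finally show "rank Y = 1" by (simp add: row_rank_def_gen)
qed

lemma cdot_self: "cdot u u = of_real ((norm u)\<^sup>2)"
proof -
  have "cdot u u = (\<Sum>i\<in>UNIV. of_real ((norm (u $ i))\<^sup>2))"
    unfolding cdot_def by (intro sum.cong refl) (metis complex_norm_square mult.commute)
  also have "\<dots> = of_real ((norm u)\<^sup>2)"
    by (simp add: norm_vec_def L2_set_def sum_nonneg)
  finally show ?thesis .
qed

definition compl_proj :: "complex^'n \<Rightarrow> complex^'n^'n" where
  "compl_proj u = mat 1 - outer u u"

lemma compl_proj_adj: "cmat_adj (compl_proj u) = compl_proj u"
  by (auto simp: compl_proj_def cmat_adj_def outer_def mat_def vec_eq_iff)

lemma outer_mult: "outer c d *v b = cdot d b *s c"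
  by (simp add: outer_def cdot_def matrix_vector_mult_def vec_eq_iff sum_distrib_left
      sum_distrib_right mult_ac)

lemma compl_proj_mult: "compl_proj u *v w = w - cdot u w *s u"
  by (simp add: compl_proj_def matrix_vector_mult_diff_rdistrib outer_mult)

lemma compl_proj_perp: "norm u = 1 \<Longrightarrow> cdot u (compl_proj u *v w) = 0"
proof -
  assume "norm u = 1"
  then have "cdot u u = 1" by (simp add: cdot_self)
  moreover have "cdot u (w - c *s u) = cdot u w - c * cdot u u" for c
    by (simp add: cdot_def right_diff_distrib sum_subtractf sum_distrib_left mult_ac)
  ultimately show ?thesis by (simp add: compl_proj_mult)
qed

lemma compl_proj_self: "norm u = 1 \<Longrightarrow> compl_proj u *v u = 0"
  by (simp add: compl_proj_mult cdot_self)

lemma compl_proj_idem: "norm u = 1 \<Longrightarrow> compl_proj u ** compl_proj u = compl_proj u"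
  unfolding matrix_eq
  by (simp flip: matrix_vector_mul_assoc)
     (simp add: compl_proj_mult[of u "compl_proj u *v _"] compl_proj_perp)

lemma cdot_adj: "cdot (cmat_adj M *v a) b = cdot a (M *v b)"
proof -
  have "cdot (cmat_adj M *v a) b = (\<Sum>i\<in>UNIV. \<Sum>j\<in>UNIV. M $ j $ i * cnj (a $ j) * b $ i)"
    by (simp add: cdot_def matrix_vector_mult_def cmat_adj_def sum_distrib_right)
  also have "\<dots> = (\<Sum>j\<in>UNIV. \<Sum>i\<in>UNIV. M $ j $ i * cnj (a $ j) * b $ i)" by (rule sum.swap)
  also have "\<dots> = cdot a (M *v b)"
    by (simp add: cdot_def matrix_vector_mult_def sum_distrib_left mult_ac)
  finally show ?thesis .
qed

lemma cdot_outer: "cdot a (outer c d *v b) = cdot a c * cdot d b"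
  by (simp add: cdot_def outer_def matrix_vector_mult_def sum_distrib_left sum_distrib_right mult_ac)
     (rule sum.swap)

lemma cdot_eq_0_imp: "(\<And>a. cdot a x = 0) \<Longrightarrow> x = 0"
  using cdot_self[of x] by simp

lemma bounded_linear_cdot_mult: "bounded_linear (\<lambda>M. cdot a (M *v b))"
  for a :: "complex^'m" and b :: "complex^'n"
proof (rule linear_conv_bounded_linear[THEN iffD1], rule linearI)
  show "cdot a ((M + N) *v b) = cdot a (M *v b) + cdot a (N *v b)" for M N :: "complex^'n^'m"
    by (simp add: cdot_def matrix_vector_mult_add_rdistrib distrib_left sum.distrib)
  show "cdot a ((r *\<^sub>R M) *v b) = r *\<^sub>R cdot a (M *v b)" for r and M :: "complex^'n^'m"
    by (simp add: cdot_def matrix_vector_mult_def scaleR_sum_right sum_distrib_left mult_ac)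
qed

lemma tangent_space_eq:
  fixes u v :: "complex^'n"
  assumes u: "norm u = 1" and v: "norm v = 1" and s: "\<sigma> \<noteq> 0" and Y: "Y = outer (\<sigma> *s u) v"
  shows "tangent_space Y = {Z. compl_proj u ** Z ** compl_proj v = 0}"
proof (intro equalityI subsetI)
  fix Z assume "Z \<in> tangent_space Y"
  then obtain \<gamma> where g0: "\<gamma> 0 = Y" and g1: "\<forall>\<^sub>F t in nhds 0. \<gamma> t \<in> rank_one"
    and gd: "(\<gamma> has_vector_derivative Z) (at 0)" unfolding tangent_space_def by blast
  have sc: "cdot a (\<sigma> *s u) = \<sigma> * cdot a u" for a
    by (simp add: cdot_def sum_distrib_left mult_ac)
  have uu: "cdot u u = 1" "cdot v v = 1" using u v by (simp_all add: cdot_self)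
  have perp: "cdot a (Z *v b) = 0" if a: "cdot a u = 0" and b: "cdot v b = 0" for a b
  proof -
    let ?B = "\<lambda>a b t. cdot a (\<gamma> t *v b)"
    have dB: "(?B a b has_vector_derivative cdot a (Z *v b)) (at 0)" for a b
      by (rule bounded_linear.has_vector_derivative[OF bounded_linear_cdot_mult gd])
    let ?h = "\<lambda>t. ?B a b t * ?B u v t - ?B a v t * ?B u b t"
    have "(?h has_vector_derivative
        (?B a b 0 * cdot u (Z *v v) + cdot a (Z *v b) * ?B u v 0) -
        (?B a v 0 * cdot u (Z *v b) + cdot a (Z *v v) * ?B u b 0)) (at 0)"
      by (intro derivative_intros has_vector_derivative_mult dB)
    then have 1: "(?h has_vector_derivative cdot a (Z *v b) * \<sigma>) (at 0)"
      by (simp add: g0 Y cdot_outer sc a b uu)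
    have "\<forall>\<^sub>F t in nhds 0. ?h t = 0"
      using g1
    proof eventually_elim
      case (elim t)
      then obtain c d where "\<gamma> t = outer c d" using rank_eq_1_iff[of "\<gamma> t"] unfolding rank_one_def by blast
      then show ?case by (simp add: cdot_outer)
    qed
    then obtain U where U: "open U" "0 \<in> U" "\<And>t. t \<in> U \<Longrightarrow> ?h t = 0"
      unfolding eventually_nhds by blast
    have "((\<lambda>t. 0) has_vector_derivative cdot a (Z *v b) * \<sigma>) (at 0)"
      by (rule has_vector_derivative_transform_within_open[OF 1 U(1,2)]) (use U(3) in auto)
    moreover have "((\<lambda>t::real. 0::complex) has_vector_derivative 0) (at 0)" by simp
    ultimately have "cdot a (Z *v b) * \<sigma> = 0" using vector_derivative_unique_at by blast
    then show ?thesis using s by simp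
  qed
  have cs: "cdot (compl_proj u *v a) u = 0" for a
    using cdot_adj[of "compl_proj u" a u] by (simp add: compl_proj_adj compl_proj_self[OF u] cdot_def)
  have "(compl_proj u ** Z ** compl_proj v) *v b = 0" for b
  proof (rule cdot_eq_0_imp)
    fix a
    have "cdot a ((compl_proj u ** Z ** compl_proj v) *v b)
      = cdot (compl_proj u *v a) (Z *v (compl_proj v *v b))"
      using cdot_adj[of "compl_proj u" a "Z *v (compl_proj v *v b)"]
      by (simp add: compl_proj_adj matrix_vector_mul_assoc matrix_mul_assoc)
    also have "\<dots> = 0" by (rule perp[OF cs compl_proj_perp[OF v]])
    finally show "cdot a ((compl_proj u ** Z ** compl_proj v) *v b) = 0" .
  qed
  then have "compl_proj u ** Z ** compl_proj v = 0" by (simp add: matrix_eq)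
  then show "Z \<in> {Z. compl_proj u ** Z ** compl_proj v = 0}" by simp
next
  fix Z assume "Z \<in> {Z. compl_proj u ** Z ** compl_proj v = 0}"
  then have Z0: "compl_proj u ** Z ** compl_proj v = 0" by simp
  define p where "p = Z *v v"
  define q where "q = inverse (cnj \<sigma>) *s (compl_proj v *v (cmat_adj Z *v u))"
  have Zeq: "Z = outer p v + outer (\<sigma> *s u) q"
    unfolding matrix_eq
  proof
    fix b
    have "compl_proj u *v (Z *v (compl_proj v *v b)) = 0"
      using Z0 by (simp add: matrix_vector_mul_assoc matrix_mul_assoc)
    then have "Z *v (compl_proj v *v b) = cdot u (Z *v (compl_proj v *v b)) *s u"
      by (simp add: compl_proj_mult[of u])
    moreover have "Z *v b = cdot v b *s p + Z *v (compl_proj v *v b)"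
      by (simp add: compl_proj_mult p_def matrix_vector_mult_diff_distrib vector_scalar_commute)
    moreover have "\<sigma> * cdot q b = cdot u (Z *v (compl_proj v *v b))"
    proof -
      have "cdot (inverse (cnj \<sigma>) *s w) b = inverse \<sigma> * cdot w b" for w
        by (simp add: cdot_def sum_distrib_left mult_ac)
      then have "\<sigma> * cdot q b = cdot (compl_proj v *v (cmat_adj Z *v u)) b"
        using s by (simp add: q_def)
      then show ?thesis
        using cdot_adj[of "compl_proj v" "cmat_adj Z *v u" b] by (simp add: compl_proj_adj cdot_adj)
    qed
    ultimately show "Z *v b = (outer p v + outer (\<sigma> *s u) q) *v b"
      by (simp add: matrix_vector_mult_add_rdistrib outer_mult mult_ac)
  qed
  define \<gamma> where "\<gamma> = (\<lambda>t::real. outer (\<sigma> *s u + t *\<^sub>R p) (v + t *\<^sub>R q))"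
  have "\<gamma> 0 = Y" by (simp add: \<gamma>_def Y)
  moreover have "\<forall>\<^sub>F t in nhds 0. \<gamma> t \<in> rank_one"
  proof -
    have nz: "\<sigma> *s u \<noteq> 0" "v \<noteq> 0" using u v s by auto
    have ev: "\<forall>\<^sub>F t::real in nhds 0. w + t *\<^sub>R z \<noteq> 0" if "w \<noteq> 0" for w z :: "complex^'n"
    proof -
      have "continuous_on UNIV (\<lambda>t::real. w + t *\<^sub>R z)" by (intro continuous_intros)
      then have "open {t. w + t *\<^sub>R z \<noteq> 0}" by (intro open_Collect_neq continuous_intros)
      then show ?thesis unfolding eventually_nhds using that by (intro exI[of _ "{t. w + t *\<^sub>R z \<noteq> 0}"]) auto
    qed
    show ?thesis using ev[OF nz(1), of p] ev[OF nz(2), of q]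
      by eventually_elim (unfold \<gamma>_def rank_one_def mem_Collect_eq rank_eq_1_iff, blast)
  qed
  moreover have "(\<gamma> has_vector_derivative Z) (at 0)"
  proof -
    define R where "R = outer p q"
    have g: "\<gamma> = (\<lambda>t. Y + t *\<^sub>R Z + (t * t) *\<^sub>R R)"
      by (rule ext) (simp add: \<gamma>_def Y Zeq R_def outer_def vec_eq_iff,
          simp add: scaleR_conv_of_real algebra_simps)
    have "((\<lambda>t. Y + t *\<^sub>R Z + (t * t) *\<^sub>R R) has_vector_derivative Z) (at 0)"
      by (auto intro!: derivative_eq_intros)
    then show ?thesis by (simp add: g)
  qed
  ultimately show "Z \<in> tangent_space Y" unfolding tangent_space_def by blast
qed

lemma frob_inner_sandwich:
  fixes V P Z Q :: "complex^'n^'n"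
  shows "frob_inner V (P ** Z ** Q) = frob_inner (cmat_adj P ** V ** cmat_adj Q) Z"
proof -
  have adj: "cmat_adj (A ** B) = cmat_adj B ** cmat_adj A" for A B :: "complex^'n^'n"
    by (simp add: cmat_adj_def matrix_matrix_mult_def vec_eq_iff mult_ac)
  have inv: "cmat_adj (cmat_adj A) = A" for A :: "complex^'n^'n"
    by (simp add: cmat_adj_def vec_eq_iff)
  have "frob_inner (cmat_adj P ** V ** cmat_adj Q) Z = trace (Q ** (cmat_adj V ** P ** Z))"
    by (simp add: frob_inner_def adj inv matrix_mul_assoc)
  also have "\<dots> = trace ((cmat_adj V ** P ** Z) ** Q)" by (rule trace_mul_sym)
  finally show ?thesis by (simp add: frob_inner_def matrix_mul_assoc)
qed

text \<open>The explicit formula \<open>P\<^sub>Y Z = Z - (I - u u\<^sup>*) Z (I - v v\<^sup>*)\<close>.\<close>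
lemma tangent_proj_eq:
  assumes u: "norm u = 1" and v: "norm v = 1" and s: "\<sigma> \<noteq> 0" and Y: "Y = outer (\<sigma> *s u) v"
  shows "tangent_proj Y Z = Z - (mat 1 - outer u u) ** Z ** (mat 1 - outer v v)"
proof -
  let ?P = "compl_proj u" and ?Q = "compl_proj v"
  note T = tangent_space_eq[OF assms]
  have dist: "?P ** (A - B) ** ?Q = ?P ** A ** ?Q - ?P ** B ** ?Q" for A B
    unfolding matrix_eq
    by (simp add: matrix_vector_mult_diff_distrib matrix_vector_mult_diff_rdistrib
        flip: matrix_vector_mul_assoc)
  have bl: "linear (\<lambda>Z. ?P ** Z ** ?Q)"
  proof (rule linearI)
    show "?P ** (A + B) ** ?Q = ?P ** A ** ?Q + ?P ** B ** ?Q" for A B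
      unfolding matrix_eq
      by (simp add: matrix_vector_right_distrib matrix_vector_mult_add_rdistrib
          flip: matrix_vector_mul_assoc)
    show "?P ** (r *\<^sub>R A) ** ?Q = r *\<^sub>R (?P ** A ** ?Q)" for r A
      by (simp add: matrix_matrix_mult_def vec_eq_iff scaleR_sum_right sum_distrib_right
          sum_distrib_left mult_ac)
  qed
  have sub: "subspace (tangent_space Y)"
    unfolding T using linear_subspace_kernel[OF bl] by simp
  have "orth_proj (tangent_space Y) Z = Z - ?P ** Z ** ?Q"
  proof (rule orth_proj_eqI[OF sub])
    have "?P ** (?P ** Z ** ?Q) ** ?Q = (?P ** ?P) ** Z ** (?Q ** ?Q)"
      by (simp only: matrix_mul_assoc)
    then show "Z - ?P ** Z ** ?Q \<in> tangent_space Y"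
      by (simp add: T dist compl_proj_idem u v)
    show "Re (frob_inner V (Z - (Z - ?P ** Z ** ?Q))) = 0" if "V \<in> tangent_space Y" for V
      using that
      by (simp add: T frob_inner_sandwich compl_proj_adj) (simp add: frob_inner_def cmat_adj_def
          matrix_matrix_mult_def trace_def)
  qed
  then show ?thesis by (simp add: tangent_proj_def compl_proj_def)
qed

end

theory Submission
  imports Defs
begin

text \<open>
  The gradient is a matrix of the form \<open>a b\<^sup>*\<close>, and this is its only relevant property.
  A stationary point \<open>E\<close> of (1) satisfies \<open>\<Pi>G = \<mu>E\<close> with \<open>\<mu> \<noteq> 0\<close>, so \<open>Y = \<mu>\<^sup>-\<^sup>1G\<close> has rank one
  and projects to \<open>E\<close>. Conversely, stationarity of \<open>Y = \<sigma>uv\<^sup>*\<close> in (2) gives \<open>P\<^sub>Y G = \<mu>Y\<close>;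
  applied to \<open>v\<close> this reads \<open>Gv = \<mu>\<sigma>u \<noteq> 0\<close>, so the range of \<open>G\<close> is spanned by \<open>u\<close>, which kills
  the normal component \<open>(I - uu\<^sup>*)G(I - vv\<^sup>*)\<close>.
\<close>

lemma gradient_outerE:
  obtains a b where "gradient A \<epsilon> lam f E = outer a b"
  by (rule that[of "(2 * _) *s fst _" "snd _"]) (simp add: gradient_def Let_def case_prod_beta)

lemma outer_in_rank_one: "outer a b \<noteq> 0 \<Longrightarrow> outer a b \<in> rank_one"
  unfolding rank_one_def mem_Collect_eq rank_eq_1_iff
  by (intro exI[of _ a] exI[of _ b]) (auto simp: outer_def vec_eq_iff)

lemma scaleR_outer: "r *\<^sub>R outer a b = outer (complex_of_real r *s a) b"
  by (simp add: outer_def vec_eq_iff scaleR_conv_of_real[where 'a = complex])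

text \<open>Supplies the form that \<open>tangent_proj_eq\<close> asks for: the lengths of both
  factors are moved into \<sigma>.\<close>

lemma rank_one_normalizedE:
  fixes Y :: "complex^'n^'n"
  assumes "Y \<in> rank_one"
  obtains \<sigma> u v where "norm u = 1" "norm v = 1" "\<sigma> \<noteq> 0" "Y = outer (\<sigma> *s u) v"
proof -
  obtain a b where ab: "a \<noteq> 0" "b \<noteq> 0" "Y = outer a b"
    using assms unfolding rank_one_def mem_Collect_eq rank_eq_1_iff by blast
  show thesis
  proof
    show "norm (sgn a) = 1" "norm (sgn b) = 1" using ab by (simp_all add: norm_sgn)
    show "complex_of_real (norm a * norm b) \<noteq> 0" using ab by simp
    show "Y = outer (complex_of_real (norm a * norm b) *s sgn a) (sgn b)"
      using ab by (simp add: outer_def vec_eq_iff sgn_div_norm scaleR_conv_of_real[where 'a = complex]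
          field_simps)
  qed
qed

lemma compl_proj_mult_outer:
  fixes u a b :: "complex^'n"
  shows "compl_proj u *v a = 0 \<Longrightarrow> compl_proj u ** outer a b = 0"
  unfolding matrix_eq
  by (simp add: outer_mult vector_scalar_commute flip: matrix_vector_mul_assoc)

text \<open>The rank-one matrices form a cone, so the line through \<open>Y\<close> is tangent at
  \<open>Y\<close>. Concretely, the columns of \<open>Y\<close> are multiples of \<open>u\<close>,
  which \<open>compl_proj u\<close> kills, and the normal component vanishes.\<close>

lemma tangent_proj_rank_one_self:
  fixes Y :: "complex^'n^'n"
  assumes "Y \<in> rank_one"
  shows "tangent_proj Y (r *\<^sub>R Y) = r *\<^sub>R Y"
proof -
  obtain \<sigma> u v where Y: "norm u = 1" "norm v = 1" "\<sigma> \<noteq> 0" "Y = outer (\<sigma> *s u) v"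
    using rank_one_normalizedE[OF assms] .
  have "compl_proj u ** (r *\<^sub>R Y) = 0"
    unfolding Y(4) scaleR_outer
    by (rule compl_proj_mult_outer) (simp add: vector_scalar_commute compl_proj_self[OF Y(1)])
  then show ?thesis
    using tangent_proj_eq[OF Y] by (simp flip: compl_proj_def)
qed

text \<open>For a general matrix the projection may lose a normal component. For
  \<open>outer a b\<close> nothing is lost, since a nonzero tangential part along \<open>Y\<close>
  forces \<open>a\<close> to be parallel to the left factor of \<open>Y\<close>.\<close>

lemma tangent_proj_outer_eq_scaleR_imp:
  fixes Y :: "complex^'n^'n"
  assumes "Y \<in> rank_one" and P: "tangent_proj Y (outer a b) = r *\<^sub>R Y" and "r \<noteq> 0"
  shows "outer a b = r *\<^sub>R Y"
proof -
  obtain \<sigma> u v where Y: "norm u = 1" "norm v = 1" "\<sigma> \<noteq> 0" "Y = outer (\<sigma> *s u) v"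
    using rank_one_normalizedE[OF assms(1)] .
  have T: "outer a b - compl_proj u ** outer a b ** compl_proj v = r *\<^sub>R Y"
    using tangent_proj_eq[OF Y] P by (simp flip: compl_proj_def)
  define k where "k = complex_of_real r * \<sigma>"
  have "k \<noteq> 0" using assms(3) Y(3) by (simp add: k_def)
  \<comment> \<open>Applying \<open>T\<close> to \<open>v\<close> removes the unknown normal
    component, because \<open>compl_proj v\<close> annihilates \<open>v\<close>.\<close>
  have "outer a b *v v = (r *\<^sub>R Y) *v v"
    unfolding T[symmetric]
    by (simp add: matrix_vector_mult_diff_rdistrib compl_proj_self[OF Y(2)]
        flip: matrix_vector_mul_assoc)
  also have "\<dots> = k *s u"
    by (simp add: Y(4) scaleR_outer outer_mult cdot_self Y(2) k_def vector_smult_assoc)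
  finally have "cdot b v *s a = k *s u" by (simp add: outer_mult)
  \<comment> \<open>Solving for \<open>u\<close> first needs only \<open>k\<close> to be nonzero; as
    \<open>u\<close> is a unit vector, this then shows that \<open>cdot b v\<close> is nonzero, so
    that one may solve for \<open>a\<close>.\<close>
  then have "u = (cdot b v / k) *s a"
    using \<open>k \<noteq> 0\<close> by (simp add: vec_eq_iff field_simps)
  moreover have "u \<noteq> 0" using Y(1) by auto
  ultimately have "cdot b v \<noteq> 0" by auto
  with \<open>cdot b v *s a = k *s u\<close> have "a = (k / cdot b v) *s u"
    by (simp add: vec_eq_iff field_simps)
  then have "compl_proj u *v a = 0"
    by (simp add: vector_scalar_commute compl_proj_self[OF Y(1)])
  then show ?thesis using T by (simp add: compl_proj_mult_outer)
qed

lemma orth_proj_scaleR: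
  fixes Z :: "complex^'n^'n"
  assumes "subspace S"
  shows "orth_proj S (r *\<^sub>R Z) = r *\<^sub>R orth_proj S Z"
proof (rule orth_proj_eqI[OF assms])
  show "r *\<^sub>R orth_proj S Z \<in> S"
    using orth_proj_exists(1)[OF assms] assms by (simp add: subspace_scale)
  show "Re (frob_inner V (r *\<^sub>R Z - r *\<^sub>R orth_proj S Z)) = 0" if "V \<in> S" for V
    using orth_proj_exists(2)[OF assms that, of Z]
    by (simp add: Re_frob_inner flip: scaleR_diff_right)
qed

text \<open>The residual of the projection is orthogonal to \<open>E\<close>. This is what makes the
  coefficients in the two differential equations comparable.\<close>

lemma Re_frob_inner_orth_proj:
  fixes E :: "complex^'n^'n"
  assumes "subspace S" "E \<in> S"
  shows "Re (frob_inner (orth_proj S Z) E) = Re (frob_inner Z E)"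
  using orth_proj_exists(2)[OF assms, of Z]
  by (simp add: Re_frob_inner inner_diff_right inner_commute)

lemma stationary1_imp_stationary2:
  fixes E :: "complex^'n^'n"
  assumes S: "subspace S" and st: "stationary1 S G E" and G: "G E = outer a b"
    and nz: "orth_proj S (G E) \<noteq> 0"
  obtains Y where "Y \<in> rank_one" "E = orth_proj S Y" "stationary2 S G Y"
proof -
  \<comment> \<open>Defined without a projection, \<mu> serves for both equations: it is the
    coefficient in \<open>rhs1\<close> because \<open>E\<close> lies in \<open>S\<close>, and the
    one in \<open>rhs2\<close> once \<open>tangent_proj Y\<close> is seen to fix
    \<open>G E\<close>.\<close>
  define \<mu> where "\<mu> = Re (frob_inner (G E) E)"
  have E: "E \<in> S" "frob_norm E = 1" and PG: "orth_proj S (G E) = \<mu> *\<^sub>R E"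
    using st Re_frob_inner_orth_proj[OF S, of E "G E"]
    by (auto simp: stationary1_def rhs1_def \<mu>_def)
  have \<mu>: "\<mu> \<noteq> 0" using nz PG by auto
  define Y where "Y = inverse \<mu> *\<^sub>R G E"
  \<comment> \<open>The instance with factor 0 says that \<open>orth_proj S 0 = 0\<close>.\<close>
  have "G E \<noteq> 0" using nz orth_proj_scaleR[OF S, of 0 0] by auto
  then have "Y \<noteq> 0" using \<mu> by (simp add: Y_def)
  then have Y: "Y \<in> rank_one"
    unfolding Y_def G scaleR_outer by (rule outer_in_rank_one)
  have EY: "orth_proj S Y = E"
    by (simp add: Y_def orth_proj_scaleR[OF S] PG \<mu>)
  have GY: "G E = \<mu> *\<^sub>R Y" using \<mu> by (simp add: Y_def)
  have "tangent_proj Y (G E) = G E"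
    using tangent_proj_rank_one_self[OF Y, of \<mu>] GY by simp
  then have "rhs2 S G Y = - G E + \<mu> *\<^sub>R Y"
    by (simp add: rhs2_def EY \<mu>_def)
  then have "rhs2 S G Y = 0" using GY by simp
  then show thesis using that Y EY E by (simp add: stationary2_def)
qed

lemma stationary2_imp_stationary1:
  fixes Y :: "complex^'n^'n"
  assumes S: "subspace S" and st: "stationary2 S G Y" and E: "E = orth_proj S Y"
    and G: "G E = outer a b" and nz: "tangent_proj Y (G E) \<noteq> 0"
  shows "tangent_proj Y (G E) = G E" "\<exists>r::real. r \<noteq> 0 \<and> Y = r *\<^sub>R G E" "stationary1 S G E"
proof -
  define \<mu> where "\<mu> = Re (frob_inner (tangent_proj Y (G E)) E)"
  have Y: "Y \<in> rank_one" and nE: "frob_norm E = 1" and P: "tangent_proj Y (G E) = \<mu> *\<^sub>R Y"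
    using st by (auto simp: stationary2_def rhs2_def Let_def \<mu>_def E)
  have \<mu>: "\<mu> \<noteq> 0" using nz P by auto
  have GY: "G E = \<mu> *\<^sub>R Y"
    using tangent_proj_outer_eq_scaleR_imp[OF Y _ \<mu>] P G by metis
  show "tangent_proj Y (G E) = G E" using P GY by simp
  have "Y = inverse \<mu> *\<^sub>R G E" using GY \<mu> by simp
  then show "\<exists>r::real. r \<noteq> 0 \<and> Y = r *\<^sub>R G E"
    using \<mu> by (intro exI[of _ "inverse \<mu>"]) simp
  have "orth_proj S (G E) = \<mu> *\<^sub>R E"
    unfolding GY orth_proj_scaleR[OF S] E[symmetric] ..
  \<comment> \<open>By the unit norm, the coefficient in \<open>rhs1\<close>, which is \<mu> times
    \<open>inner E E\<close>, equals \<mu>, so the two terms cancel.\<close>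
  moreover have "inner E E = 1"
    using nE by (simp add: frob_norm_eq_norm norm_eq_1)
  ultimately show "stationary1 S G E"
    using nE orth_proj_exists(1)[OF S, of Y]
    by (simp add: stationary1_def rhs1_def Re_frob_inner flip: E)
qed

theorem theorem3p1:
  fixes A :: "complex^'n^'n" and \<epsilon> :: real and S :: "(complex^'n^'n) set"
    and lam :: "complex^'n^'n \<Rightarrow> complex" and f :: "complex \<times> complex \<Rightarrow> complex"
    and G :: "complex^'n^'n \<Rightarrow> complex^'n^'n"
  assumes eps: "\<epsilon> > 0"
    and S: "subspace S"
    and lam: "\<And>M. is_eigenvalue M (lam M)"
    and f_smooth: "smooth_fun f"
    and f_real: "\<And>z. f (z, cnj z) = f (cnj z, z) \<and> f (z, cnj z) \<in> \<real>"
    and G: "G = gradient A \<epsilon> lam f"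
  shows
    "(\<forall>E. stationary1 S G E \<and> simple_eigenvalue (A + \<epsilon> *\<^sub>R E) (lam (A + \<epsilon> *\<^sub>R E)) \<and>
          orth_proj S (G E) \<noteq> 0 \<longrightarrow>
        (\<exists>Y. Y \<in> rank_one \<and> E = orth_proj S Y \<and> stationary2 S G Y)) \<and>
     (\<forall>Y E. stationary2 S G Y \<and> E = orth_proj S Y \<and>
          simple_eigenvalue (A + \<epsilon> *\<^sub>R E) (lam (A + \<epsilon> *\<^sub>R E)) \<and>
          tangent_proj Y (G E) \<noteq> 0 \<longrightarrow>
        tangent_proj Y (G E) = G E \<and> (\<exists>r::real. r \<noteq> 0 \<and> Y = r *\<^sub>R G E) \<and> stationary1 S G E)"
proof (intro conjI allI impI)
  fix E
  assume "stationary1 S G E \<and> simple_eigenvalue (A + \<epsilon> *\<^sub>R E) (lam (A + \<epsilon> *\<^sub>R E)) \<and>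
    orth_proj S (G E) \<noteq> 0"
  then show "\<exists>Y. Y \<in> rank_one \<and> E = orth_proj S Y \<and> stationary2 S G Y"
    using gradient_outerE[of A \<epsilon> lam f E] stationary1_imp_stationary2[OF S, of G E]
    unfolding G by metis
next
  fix Y E
  assume *: "stationary2 S G Y \<and> E = orth_proj S Y \<and>
    simple_eigenvalue (A + \<epsilon> *\<^sub>R E) (lam (A + \<epsilon> *\<^sub>R E)) \<and> tangent_proj Y (G E) \<noteq> 0"
  obtain a b where "G E = outer a b"
    using gradient_outerE unfolding G .
  note concl = stationary2_imp_stationary1[where G = G, OF S _ _ this, of Y]
  show "tangent_proj Y (G E) = G E" "\<exists>r::real. r \<noteq> 0 \<and> Y = r *\<^sub>R G E" "stationary1 S G E"
    using concl * by auto
qed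

end
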